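(* Consider the outer gradient method $$x_{k+1}=x_k-\frac{\mu_2}{L_{11}\mu_2+L_{12}^2}\,\nabla_x f(x_k,\hat y_k),\qquad k=0,1,2,\dots,$$ where for each $k$ the point $\hat y_k$ is the output of the inner gradient method $y_{m+1}=y_m+\frac{1}{L_{22}}\nabla_y f(x_k,y_m)$ stopped at the first $m$ for which $\|\nabla_y f(x_k,y_m)\|\le\mu_2\gamma$ (and $\hat y_k=y_m$ for this $m$). Let $g(x)=\max_y f(x,y)$ and let $C_1\ge 0$ be such that $g(x_0)-g(x^* )\le C_1$. Then the stopping criterion $$\|\nabla_x f(x_N,\hat y_N)\|\le L_{12}\gamma\sqrt6$$ is satisfied at some iteration $$N\le\left\lceil 2C_1\,\frac{L_{11}+\frac{L_{12}^2}{\mu_2}}{L_{12}^2\gamma^2}\right\rceil .$$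
   Context: Let $f:\mathbb{R}^n\times\mathbb{R}^{m_0}\to\mathbb{R}$ be differentiable; $\|\cdot\|$ is the Euclidean norm. The problem is to find a point $(x^*,y^* )$ with $f(x^*,y^* )=\min_x\max_y f(x,y)$, which is assumed to exist; in particular $x^*$ is a minimizer of $g(x)=\max_y f(x,y)$. Two-sided Polyak–Łojasiewicz (PL) condition, with $\mu_1,\mu_2>0$: for all $x,y$, $$\|\nabla_x f(x,y)\|^2\ge 2\mu_1\big(f(x,y)-\min_{x'} f(x',y)\big),\qquad \|\nabla_y f(x,y)\|^2\ge 2\mu_2\big(\max_{y'} f(x,y')-f(x,y)\big),$$ where the minima over $x'$ and maxima over $y'$ are finite and attained (nonempty solution sets). Lipschitz conditions, with positive constants $L_{11},L_{12},L_{22}$: for all $x,x_1,x_2,y,y_1,y_2$, $$\|\nabla_x f(x_1,y)-\nabla_x f(x_2,y)\|\le L_{11}\|x_1-x_2\|,\quad \|\nabla_x f(x,y_1)-\nabla_x f(x,y_2)\|\le L_{12}\|y_1-y_2\|,$$ $$\|\nabla_y f(x,y_1)-\nabla_y f(x,y_2)\|\le L_{22}\|y_1-y_2\|,\quad \|\nabla_y f(x_1,y)-\nabla_y f(x_2,y)\|\le L_{12}\|x_1-x_2\|.$$ The number $\gamma>0$ is a fixed accuracy parameter for the inner problems $\max_y f(x_k,y)$. The starting points $x_0$ and those of the inner methods are arbitrary. The vector $\nabla_x f(x_k,\hat y_k)$ serves as an inexact gradient of $g$ at $x_k$. *)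

theory Defs
  imports "HOL-Analysis.Analysis"
begin

text \<open>Unspecified where \<open>h\<close> is not differentiable; see \<open>GDERIV_grad\<close> below.\<close>
definition grad :: "('a::real_inner \<Rightarrow> real) \<Rightarrow> 'a \<Rightarrow> 'a" where
  "grad h z = (THE D. GDERIV h z :> D)"

definition grad_x :: "((real ^ 'n) \<times> (real ^ 'm) \<Rightarrow> real) \<Rightarrow> real ^ 'n \<Rightarrow> real ^ 'm \<Rightarrow> real ^ 'n" where
  "grad_x f x y = grad (\<lambda>x'. f (x', y)) x"

definition grad_y :: "((real ^ 'n) \<times> (real ^ 'm) \<Rightarrow> real) \<Rightarrow> real ^ 'n \<Rightarrow> real ^ 'm \<Rightarrow> real ^ 'm" where
  "grad_y f x y = grad (\<lambda>y'. f (x, y')) y"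

text \<open>Under the attainment assumptions in \<open>two_sided_PL\<close>, the supremum is a maximum.\<close>
definition max_y :: "((real ^ 'n) \<times> (real ^ 'm) \<Rightarrow> real) \<Rightarrow> real ^ 'n \<Rightarrow> real" where
  "max_y f x = (SUP y. f (x, y))"

definition min_x :: "((real ^ 'n) \<times> (real ^ 'm) \<Rightarrow> real) \<Rightarrow> real ^ 'm \<Rightarrow> real" where
  "min_x f y = (INF x. f (x, y))"

text \<open>The first two conjuncts say that the inner minima and maxima are attained (hence finite).\<close>
definition two_sided_PL ::
    "((real ^ 'n) \<times> (real ^ 'm) \<Rightarrow> real) \<Rightarrow> real \<Rightarrow> real \<Rightarrow> bool" where
  "two_sided_PL f \<mu>1 \<mu>2 \<longleftrightarrow>
     (\<forall>y. \<exists>x. \<forall>x'. f (x, y) \<le> f (x', y)) \<and>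
     (\<forall>x. \<exists>y. \<forall>y'. f (x, y') \<le> f (x, y)) \<and>
     (\<forall>x y. (norm (grad_x f x y))\<^sup>2 \<ge> 2 * \<mu>1 * (f (x, y) - min_x f y)) \<and>
     (\<forall>x y. (norm (grad_y f x y))\<^sup>2 \<ge> 2 * \<mu>2 * (max_y f x - f (x, y)))"

definition lipschitz_gradients ::
    "((real ^ 'n) \<times> (real ^ 'm) \<Rightarrow> real) \<Rightarrow> real \<Rightarrow> real \<Rightarrow> real \<Rightarrow> bool" where
  "lipschitz_gradients f L11 L12 L22 \<longleftrightarrow>
     (\<forall>y. L11-lipschitz_on UNIV (\<lambda>x. grad_x f x y)) \<and>
     (\<forall>x. L12-lipschitz_on UNIV (\<lambda>y. grad_x f x y)) \<and>
     (\<forall>x. L22-lipschitz_on UNIV (\<lambda>y. grad_y f x y)) \<and>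
     (\<forall>y. L12-lipschitz_on UNIV (\<lambda>x. grad_y f x y))"

primrec inner_iterate ::
    "((real ^ 'n) \<times> (real ^ 'm) \<Rightarrow> real) \<Rightarrow> real \<Rightarrow> real ^ 'n \<Rightarrow> real ^ 'm \<Rightarrow> nat \<Rightarrow> real ^ 'm" where
  "inner_iterate f L x y0 0 = y0"
| "inner_iterate f L x y0 (Suc m) =
     inner_iterate f L x y0 m + (1 / L) *\<^sub>R grad_y f x (inner_iterate f L x y0 m)"

text \<open>
  The first iterate whose gradient norm is at most \<open>tol\<close>.  That there is one, so that
  \<open>LEAST\<close> is meaningful, is \<open>inner_method_stops\<close> below.
\<close>
definition inner_output ::
    "((real ^ 'n) \<times> (real ^ 'm) \<Rightarrow> real) \<Rightarrow> real \<Rightarrow> real \<Rightarrow> real ^ 'n \<Rightarrow> real ^ 'm \<Rightarrow> real ^ 'm" where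
  "inner_output f L tol x y0 =
     inner_iterate f L x y0 (LEAST m. norm (grad_y f x (inner_iterate f L x y0 m)) \<le> tol)"

lemma GDERIV_grad:
  fixes h :: "'a::euclidean_space \<Rightarrow> real"
  assumes "h differentiable (at z)"
  shows "GDERIV h z :> grad h z"
proof -
  obtain h' where h': "(h has_derivative h') (at z)"
    using assms by (auto simp: differentiable_def)
  define D where "D = (\<Sum>b\<in>Basis. h' b *\<^sub>R b)"
  have lin: "linear h'"
    using h' has_derivative_linear by blast
  have "h' v = inner v D" for v
  proof -
    have "h' v = h' (\<Sum>b\<in>Basis. inner v b *\<^sub>R b)"
      by (simp add: euclidean_representation)
    also have "\<dots> = (\<Sum>b\<in>Basis. inner v b * h' b)"
      by (simp add: linear_sum[OF lin] linear_cmul[OF lin])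
    also have "\<dots> = inner v D"
      by (simp add: D_def inner_sum_right mult.commute)
    finally show ?thesis .
  qed
  then have "h' = (\<lambda>v. inner v D)" by auto
  with h' have D: "GDERIV h z :> D"
    by (simp add: gderiv_def)
  have "E = D" if "GDERIV h z :> E" for E
  proof -
    have "(\<lambda>v. inner v E) = (\<lambda>v. inner v D)"
      using that D unfolding gderiv_def by (rule has_derivative_unique)
    then have "inner v E = inner v D" for v by metis
    then show ?thesis using vector_eq_ldot by blast
  qed
  with D show ?thesis
    unfolding grad_def by (metis theI)
qed

lemma inner_method_stops:
  fixes f :: "(real ^ 'n) \<times> (real ^ 'm) \<Rightarrow> real"
  assumes diff: "f differentiable_on UNIV"
    and lip: "L-lipschitz_on UNIV (grad_y f x)" and "L > 0"
    and bdd: "bdd_above (range (\<lambda>y. f (x, y)))" and "tol > 0"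
  shows "\<exists>m. norm (grad_y f x (inner_iterate f L x y0 m)) \<le> tol"
proof (rule ccontr)
  assume "\<not> ?thesis"
  then have big: "norm (grad_y f x (inner_iterate f L x y0 m)) > tol" for m
    by (meson not_le)
  have gd: "((\<lambda>y. f (x, y)) has_derivative (\<lambda>v. inner v (grad_y f x y))) (at y)" for y
  proof -
    have "f differentiable (at (x, y))"
      using diff by (simp add: differentiable_on_def)
    moreover have "(\<lambda>y. (x, y)) differentiable (at y)"
      unfolding differentiable_def by (rule exI) (rule derivative_intros)+
    ultimately have "(f \<circ> (\<lambda>y. (x, y))) differentiable (at y)"
      by (intro differentiable_chain_at) auto
    then have "GDERIV (\<lambda>y. f (x, y)) y :> grad_y f x y"
      unfolding grad_y_def by (intro GDERIV_grad) (simp add: o_def)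
    then show ?thesis by (simp add: gderiv_def)
  qed
  have ascent: "f (x, y + (1 / L) *\<^sub>R grad_y f x y) \<ge> f (x, y) + (norm (grad_y f x y))\<^sup>2 / (2 * L)"
    for y
  proof -
    define v where "v = grad_y f x y"
    define \<phi> where
      "\<phi> = (\<lambda>t. f (x, y + t *\<^sub>R v) - t * (norm v)\<^sup>2 + L * t\<^sup>2 * (norm v)\<^sup>2 / 2)"
    define \<phi>' where
      "\<phi>' = (\<lambda>t. inner v (grad_y f x (y + t *\<^sub>R v)) - (norm v)\<^sup>2 + L * t * (norm v)\<^sup>2)"
    have der: "(\<phi> has_real_derivative \<phi>' t) (at t)" for t
    proof -
      have "((\<lambda>t. y + t *\<^sub>R v) has_derivative (\<lambda>s. s *\<^sub>R v)) (at t)"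
        by (auto intro!: derivative_eq_intros)
      from has_derivative_compose[OF this gd]
      have "((\<lambda>t. f (x, y + t *\<^sub>R v)) has_real_derivative
              inner v (grad_y f x (y + t *\<^sub>R v))) (at t)"
        by (simp add: has_field_derivative_def mult.commute fun_eq_iff)
          (simp add: mult_commute_abs)
      then show ?thesis
        unfolding \<phi>_def \<phi>'_def by (auto intro!: derivative_eq_intros)
    qed
    have nonneg: "\<phi>' t \<ge> 0" if "t \<ge> 0" for t
    proof -
      have "norm (v - grad_y f x (y + t *\<^sub>R v)) \<le> L * norm (t *\<^sub>R v)"
        using lipschitz_onD[OF lip, of y "y + t *\<^sub>R v"] by (simp add: v_def dist_norm)
      then have "norm (v - grad_y f x (y + t *\<^sub>R v)) \<le> L * t * norm v"
        using that by simp
      then have "norm v * norm (v - grad_y f x (y + t *\<^sub>R v)) \<le> norm v * (L * t * norm v)"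
        by (intro mult_left_mono) auto
      moreover have "inner v (v - grad_y f x (y + t *\<^sub>R v))
          \<le> norm v * norm (v - grad_y f x (y + t *\<^sub>R v))"
        by (rule norm_cauchy_schwarz)
      ultimately show ?thesis
        by (simp add: \<phi>'_def inner_diff_right power2_norm_eq_inner[symmetric]
            power2_eq_square algebra_simps)
    qed
    have "\<phi> 0 \<le> \<phi> (1 / L)"
    proof (rule DERIV_nonneg_imp_nondecreasing[where f = \<phi>])
      show "0 \<le> 1 / L" using \<open>L > 0\<close> by simp
      show "\<exists>d. (\<phi> has_real_derivative d) (at t) \<and> d \<ge> 0" if "0 \<le> t" "t \<le> 1 / L" for t
        using der nonneg that(1) by blast
    qed
    moreover have "\<phi> 0 = f (x, y)"
      by (simp add: \<phi>_def)
    moreover have "L * (1 / L)\<^sup>2 = 1 / L"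
      using \<open>L > 0\<close> by (simp add: power2_eq_square)
    then have "\<phi> (1 / L) = f (x, y + (1 / L) *\<^sub>R v) - (norm v)\<^sup>2 / (2 * L)"
      by (simp add: \<phi>_def)
    ultimately show ?thesis
      by (simp add: v_def)
  qed
  have grow: "f (x, inner_iterate f L x y0 m) \<ge> f (x, y0) + real m * (tol\<^sup>2 / (2 * L))" for m
  proof (induction m)
    case (Suc m)
    have "tol\<^sup>2 / (2 * L) \<le> (norm (grad_y f x (inner_iterate f L x y0 m)))\<^sup>2 / (2 * L)"
      using big[of m] \<open>tol > 0\<close> \<open>L > 0\<close> by (intro divide_right_mono power_mono) auto
    with Suc ascent[of "inner_iterate f L x y0 m"] show ?case
      by (simp add: algebra_simps add_divide_distrib)
  qed simp
  obtain B where B: "f (x, y) \<le> B" for y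
    using bdd by (auto simp: bdd_above_def)
  have "tol\<^sup>2 / (2 * L) > 0" using \<open>tol > 0\<close> \<open>L > 0\<close> by simp
  then obtain m where "real m * (tol\<^sup>2 / (2 * L)) > B - f (x, y0)"
    using reals_Archimedean3 by blast
  with grow[of m] B[of "inner_iterate f L x y0 m"] show False by linarith
qed

end

theory Submission
  imports Defs
begin

text \<open>
  Write \<open>g x = max\<^sub>y f (x, y)\<close> and \<open>L = L11 + L12\<^sup>2 / \<mu>2\<close>.  The outer method is gradient descent on
  \<open>g\<close> with step \<open>1 / L\<close> and an inexact gradient, and the count of iterations is the usual one:
  as long as the method does not stop, each step lowers \<open>g\<close> by a fixed amount, whereas \<open>g\<close> can
  fall by at most \<open>C1\<close> in total.

  The work is to see that \<open>g\<close> behaves like an \<open>L\<close>-smooth function although its maximizers need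
  not be unique.  The PL condition in \<open>y\<close> gives quadratic growth (\<open>PL_quadratic_growth\<close>): some
  maximizer \<open>p\<close> satisfies \<open>(\<mu>2 / 2) * (dist y p)\<^sup>2 \<le> g x - f (x, y)\<close>; combining this with PL once
  more gives the error bound \<open>\<mu>2 * dist y p \<le> norm (grad_y f x y)\<close> (\<open>PL_error_bound\<close>).  By the
  error bound, maximizers move Lipschitz continuously with \<open>x\<close>, which forces all maximizers over
  \<open>x\<close> to share the same \<open>x\<close>-gradient (\<open>Fx_maximizers_eq\<close>); this common vector plays the role of
  the gradient of \<open>g\<close>.  By quadratic growth, the corresponding quadratic upper bound on \<open>g\<close> holds
  with the constant \<open>L\<close> (\<open>max_quadratic_upper_bound\<close>).

  When the inner method stops, the error bound places its output within \<open>\<gamma>\<close> of a maximizer, so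
  the inexact gradient \<open>v\<close> differs from the exact one \<open>w\<close> by at most \<open>\<Delta> = L12 * \<gamma>\<close>.  A step of
  length \<open>1 / L\<close> along \<open>- v\<close> changes \<open>g\<close> by at most \<open>((norm (v - w))\<^sup>2 - (norm w)\<^sup>2) / (2 * L)\<close>.  If
  \<open>norm v > sqrt 6 * \<Delta>\<close>, then \<open>(norm w)\<^sup>2 \<ge> (sqrt 6 - 1)\<^sup>2 * \<Delta>\<^sup>2 \<ge> 2 * \<Delta>\<^sup>2\<close>, so \<open>g\<close> decreases by at least
  \<open>\<Delta>\<^sup>2 / (2 * L)\<close> (\<open>inexact_step_decrease\<close>).  This can happen at most \<open>2 * C1 * L / \<Delta>\<^sup>2\<close> times.
\<close>

section \<open>Functions with Lipschitz gradient\<close>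

lemma quadratic_upper_bound:
  fixes h :: "'a::euclidean_space \<Rightarrow> real"
  assumes der: "\<And>z. GDERIV h z :> G z" and lip: "L-lipschitz_on UNIV G"
  shows "h (a + d) \<le> h a + inner (G a) d + L / 2 * (norm d)\<^sup>2"
proof -
  define \<phi> where "\<phi> = (\<lambda>t. h (a + t *\<^sub>R d) - t * inner (G a) d - L * t\<^sup>2 / 2 * (norm d)\<^sup>2)"
  have line: "((\<lambda>t. h (a + t *\<^sub>R d)) has_real_derivative inner (G (a + t *\<^sub>R d)) d) (at t)" for t
  proof -
    have "((\<lambda>t. a + t *\<^sub>R d) has_derivative (\<lambda>s. s *\<^sub>R d)) (at t)"
      by (auto intro!: derivative_eq_intros)
    from has_derivative_compose[OF this der[unfolded gderiv_def]] show ?thesis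
      by (simp add: has_field_derivative_def inner_commute mult_commute_abs)
  qed
  have "\<phi> 1 \<le> \<phi> 0"
  proof (rule DERIV_nonpos_imp_nonincreasing[where f = \<phi>])
    fix t :: real assume "0 \<le> t" "t \<le> 1"
    have "inner (G (a + t *\<^sub>R d) - G a) d \<le> norm (G (a + t *\<^sub>R d) - G a) * norm d"
      by (rule norm_cauchy_schwarz)
    also have "\<dots> \<le> L * t * norm d * norm d"
      using lipschitz_onD[OF lip, of "a + t *\<^sub>R d" a] \<open>0 \<le> t\<close>
      by (intro mult_right_mono) (auto simp: dist_norm mult.assoc)
    finally have "inner (G (a + t *\<^sub>R d)) d - inner (G a) d - L * t * (norm d)\<^sup>2 \<le> 0"
      by (simp add: inner_diff_left power2_eq_square)
    moreover have "(\<phi> has_real_derivative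
        inner (G (a + t *\<^sub>R d)) d - inner (G a) d - L * t * (norm d)\<^sup>2) (at t)"
      unfolding \<phi>_def by (auto intro!: derivative_eq_intros line)
    ultimately show "\<exists>y. (\<phi> has_real_derivative y) (at t) \<and> y \<le> 0" by blast
  qed simp
  then show ?thesis by (simp add: \<phi>_def)
qed

lemma quadratic_lower_bound:
  fixes h :: "'a::euclidean_space \<Rightarrow> real"
  assumes der: "\<And>z. GDERIV h z :> G z" and lip: "L-lipschitz_on UNIV G"
  shows "h a + inner (G a) d - L / 2 * (norm d)\<^sup>2 \<le> h (a + d)"
proof -
  have "GDERIV (\<lambda>z. - h z) z :> - G z" for z
    using der by (rule GDERIV_minus)
  moreover have "L-lipschitz_on UNIV (\<lambda>z. - G z)"
    using lip by (simp add: lipschitz_on_def dist_minus)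
  ultimately have "- h (a + d) \<le> - h a + inner (- G a) d + L / 2 * (norm d)\<^sup>2"
    by (rule quadratic_upper_bound)
  then show ?thesis by simp
qed

section \<open>Quadratic growth and error bound from the PL condition\<close>

text \<open>
  By PL, \<open>sqrt (M - h)\<close> has slope at least \<open>sqrt (\<mu> / 2)\<close> wherever it does not vanish.  For any
  \<open>c < sqrt (\<mu> / 2)\<close>, the penalized function \<open>\<Phi> z = sqrt (M - h z) + c * dist y z\<close> can therefore attain
  its minimum only at a maximizer of \<open>h\<close>, since elsewhere a step along the gradient of \<open>h\<close> lowers
  \<open>\<Phi>\<close>.  Comparing the minimum with \<open>\<Phi> y\<close> gives \<open>c * dist y z \<le> sqrt (M - h y)\<close> for some maximizer
  \<open>z\<close>.
\<close>
lemma PL_quadratic_growth: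
  fixes h :: "'a::euclidean_space \<Rightarrow> real"
  assumes der: "\<And>z. GDERIV h z :> G z" and "\<mu> > 0"
    and le: "\<And>z. h z \<le> M" and att: "h z0 = M"
    and PL: "\<And>z. 2 * \<mu> * (M - h z) \<le> (norm (G z))\<^sup>2"
  obtains p where "h p = M" "\<mu> / 2 * (dist y p)\<^sup>2 \<le> M - h y"
proof -
  have cont: "continuous_on A h" for A
    using der by (metis GDERIV_DERIV_compose gderiv_def has_derivative_at_withinI has_derivative_continuous_on)
  have "closed {z. h z = M}"
    by (intro closed_Collect_eq cont continuous_on_const)
  moreover have "{z. h z = M} \<noteq> {}" using att by auto
  ultimately obtain p where p: "h p = M" and near: "\<And>z. h z = M \<Longrightarrow> dist y p \<le> dist y z"
    using distance_attains_inf[of "{z. h z = M}" y] by auto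
  have "\<mu> / 2 * (dist y p)\<^sup>2 \<le> M - h y"
  proof (rule ccontr)
    define \<delta> where "\<delta> = (\<lambda>z. M - h z)"
    have \<delta>: "\<delta> z \<ge> 0" for z using le by (simp add: \<delta>_def)
    assume "\<not> ?thesis"
    then have far: "\<delta> y < \<mu> / 2 * (dist y p)\<^sup>2" by (simp add: \<delta>_def)
    with \<delta>[of y] have r: "dist y p > 0"
      by (cases "dist y p = 0") auto
    have "\<delta> y / (dist y p)\<^sup>2 < \<mu> / 2" using far r by (simp add: field_simps)
    \<comment> \<open>The failure of the claim leaves room for a slope \<open>c\<close> strictly below \<open>sqrt (\<mu> / 2)\<close> for which
      every maximizer still satisfies \<open>c * dist y z > sqrt (\<delta> y)\<close>.\<close>
    then obtain s where s: "\<delta> y / (dist y p)\<^sup>2 < s" "s < \<mu> / 2" using dense by blast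
    define c where "c = sqrt s"
    have "s > 0" using s(1) \<delta>[of y] r by (meson divide_nonneg_nonneg le_less_trans zero_le_power2)
    then have c: "c > 0" "c\<^sup>2 = s" by (auto simp: c_def)
    have "\<delta> y < (c * dist y p)\<^sup>2"
      using s(1) r c by (simp add: field_simps)
    then have far': "sqrt (\<delta> y) < c * dist y p"
      using c r by (intro real_less_lsqrt) auto
    define \<Phi> where "\<Phi> = (\<lambda>z. sqrt (\<delta> z) + c * dist y z)"
    have cont\<Phi>: "continuous_on A \<Phi>" for A
      unfolding \<Phi>_def \<delta>_def by (intro continuous_intros cont)
    \<comment> \<open>Outside this ball the penalty term alone exceeds \<open>\<Phi> y\<close>, so a minimum over the ball is global.\<close>
    define R where "R = \<Phi> y / c"
    have "R \<ge> 0" using c \<delta>[of y] by (simp add: R_def \<Phi>_def)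
    then have "cball y R \<noteq> {}" by simp
    then obtain z where z: "z \<in> cball y R" "\<And>w. w \<in> cball y R \<Longrightarrow> \<Phi> z \<le> \<Phi> w"
      using continuous_attains_inf[OF compact_cball _ cont\<Phi>] by blast
    have min: "\<Phi> z \<le> \<Phi> w" for w
    proof (cases "w \<in> cball y R")
      case False
      then have "\<Phi> y < c * dist y w" using c by (simp add: R_def field_simps)
      also have "\<dots> \<le> \<Phi> w" using \<delta>[of w] by (simp add: \<Phi>_def)
      finally show ?thesis using z(2)[of y] \<open>R \<ge> 0\<close> by simp
    qed (use z in auto)
    show False
    proof (cases "h z = M")
      case True
      have "c * dist y p \<le> c * dist y z" using near[OF True] c by simp
      with min[of y] True far' show False by (simp add: \<Phi>_def \<delta>_def)
    next
      case False
      then have pos: "\<delta> z > 0" using le[of z] by (simp add: \<delta>_def)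
      \<comment> \<open>For \<open>t \<ge> 0\<close>, \<open>q t + c * dist y z\<close> bounds \<open>\<Phi> (z + t *\<^sub>R G z)\<close> from above with equality at
        \<open>0\<close>; unlike \<open>\<Phi>\<close>, it is differentiable there even if \<open>z = y\<close>.\<close>
      define q where "q = (\<lambda>t. sqrt (\<delta> (z + t *\<^sub>R G z)) + c * t * norm (G z))"
      define q' where "q' = - (norm (G z))\<^sup>2 / (2 * sqrt (\<delta> z)) + c * norm (G z)"
      have "((\<lambda>t. z + t *\<^sub>R G z) has_derivative (\<lambda>s. s *\<^sub>R G z)) (at 0)"
        by (auto intro!: derivative_eq_intros)
      moreover have "(h has_derivative (\<lambda>v. inner v (G z))) (at (z + 0 *\<^sub>R G z))"
        using der[of z] by (simp add: gderiv_def)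
      ultimately have "((\<lambda>t. h (z + t *\<^sub>R G z)) has_derivative (\<lambda>s. inner (s *\<^sub>R G z) (G z))) (at 0)"
        by (rule has_derivative_compose)
      then have "((\<lambda>t. h (z + t *\<^sub>R G z)) has_real_derivative (norm (G z))\<^sup>2) (at 0)"
        by (simp add: has_field_derivative_def power2_norm_eq_inner mult_commute_abs)
      then have "((\<lambda>t. \<delta> (z + t *\<^sub>R G z)) has_real_derivative - (norm (G z))\<^sup>2) (at 0)"
        unfolding \<delta>_def by (auto intro!: derivative_eq_intros)
      then have dq: "(q has_real_derivative q') (at 0)"
        unfolding q_def q'_def using pos
        by (auto intro!: derivative_eq_intros simp: field_simps)
      have "(2 * c * sqrt (\<delta> z))\<^sup>2 = 4 * s * \<delta> z"
        using c pos by (simp add: power_mult_distrib)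
      also have "\<dots> < 2 * \<mu> * \<delta> z" using s pos by simp
      also have "\<dots> \<le> (norm (G z))\<^sup>2" using PL[of z] by (simp add: \<delta>_def)
      finally have big: "2 * c * sqrt (\<delta> z) < norm (G z)"
        by (rule power_less_imp_less_base) simp
      then have "norm (G z) > 0"
        using c pos by (meson le_less_trans mult_nonneg_nonneg less_imp_le real_sqrt_ge_zero zero_le_numeral)
      with big have "norm (G z) * (2 * c * sqrt (\<delta> z)) < norm (G z) * norm (G z)"
        by (intro mult_strict_left_mono)
      then have "q' < 0"
        using pos by (simp add: q'_def power2_eq_square field_simps)
      then obtain e where e: "e > 0" "\<And>t. t > 0 \<Longrightarrow> t < e \<Longrightarrow> q (0 + t) < q 0"
        using DERIV_neg_dec_right[OF dq] by auto
      have "q (e / 2) < q 0" using e(1) e(2)[of "e / 2"] by simp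
      moreover have "\<Phi> z \<le> \<Phi> (z + (e / 2) *\<^sub>R G z)" by (rule min)
      moreover have "dist y (z + (e / 2) *\<^sub>R G z) \<le> dist y z + e / 2 * norm (G z)"
        using dist_triangle[of y "z + (e / 2) *\<^sub>R G z" z] e(1) by (simp add: dist_norm)
      then have "c * dist y (z + (e / 2) *\<^sub>R G z) \<le> c * (dist y z + e / 2 * norm (G z))"
        using c by (intro mult_left_mono) auto
      ultimately show False
        by (simp add: q_def \<Phi>_def algebra_simps)
    qed
  qed
  with p that show ?thesis by blast
qed

lemma PL_error_bound:
  fixes h :: "'a::euclidean_space \<Rightarrow> real"
  assumes der: "\<And>z. GDERIV h z :> G z" and "\<mu> > 0"
    and le: "\<And>z. h z \<le> M" and att: "h z0 = M"
    and PL: "\<And>z. 2 * \<mu> * (M - h z) \<le> (norm (G z))\<^sup>2"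
  obtains p where "h p = M" "\<mu> * dist y p \<le> norm (G y)"
proof -
  obtain p where p: "h p = M" "\<mu> / 2 * (dist y p)\<^sup>2 \<le> M - h y"
    using PL_quadratic_growth[OF assms] .
  have "(\<mu> * dist y p)\<^sup>2 = 2 * \<mu> * (\<mu> / 2 * (dist y p)\<^sup>2)"
    by (simp add: power2_eq_square)
  also have "\<dots> \<le> 2 * \<mu> * (M - h y)"
    using p(2) \<open>\<mu> > 0\<close> by (intro mult_left_mono) auto
  also have "\<dots> \<le> (norm (G y))\<^sup>2" by (rule PL)
  finally have "\<mu> * dist y p \<le> norm (G y)"
    by (rule power2_le_imp_le) simp
  with p(1) that show ?thesis by blast
qed

section \<open>Smoothness of the max-function\<close>

locale PL_max =
  fixes F :: "'a::euclidean_space \<Rightarrow> 'b::euclidean_space \<Rightarrow> real"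
    and Fx :: "'a \<Rightarrow> 'b \<Rightarrow> 'a" and Fy :: "'a \<Rightarrow> 'b \<Rightarrow> 'b"
    and g :: "'a \<Rightarrow> real" and \<mu> L11 L12 :: real
  assumes der_x: "\<And>x y. GDERIV (\<lambda>x. F x y) x :> Fx x y"
    and der_y: "\<And>x y. GDERIV (F x) y :> Fy x y"
    and le_max: "\<And>x y. F x y \<le> g x"
    and max_attained: "\<And>x. \<exists>y. F x y = g x"
    and \<mu>: "\<mu> > 0"
    and PL: "\<And>x y. 2 * \<mu> * (g x - F x y) \<le> (norm (Fy x y))\<^sup>2"
    and L11: "\<And>y. L11-lipschitz_on UNIV (\<lambda>x. Fx x y)"
    and L12_x: "\<And>x. L12-lipschitz_on UNIV (Fx x)"
    and L12_y: "\<And>y. L12-lipschitz_on UNIV (\<lambda>x. Fy x y)"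
begin

lemma growth:
  obtains p where "F x p = g x" "\<mu> / 2 * (dist y p)\<^sup>2 \<le> g x - F x y"
proof -
  obtain z0 where "F x z0 = g x" using max_attained by blast
  from PL_quadratic_growth[OF der_y \<mu> le_max this PL] that show ?thesis by blast
qed

lemma error_bound:
  obtains p where "F x p = g x" "\<mu> * dist y p \<le> norm (Fy x y)"
proof -
  obtain z0 where "F x z0 = g x" using max_attained by blast
  from PL_error_bound[OF der_y \<mu> le_max this PL] that show ?thesis by blast
qed

lemma L12_nonneg: "L12 \<ge> 0"
  using L12_x lipschitz_on_nonneg by blast

lemma Fy_maximizer:
  assumes "F x y = g x"
  shows "Fy x y = 0"
proof -
  have "(F x has_derivative (\<lambda>v. inner v (Fy x y))) (at y)"
    using der_y by (simp add: gderiv_def)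
  then have "(\<lambda>v. inner v (Fy x y)) = (\<lambda>v. 0)"
    using differential_zero_maxmin[of y UNIV "F x"] le_max assms by auto
  then show ?thesis by (metis inner_eq_zero_iff)
qed

text \<open>
  The first-order expansion of \<open>F\<close> at \<open>(x, y')\<close> with the gradient taken at \<open>(x, y)\<close> instead: when
  \<open>y'\<close> is a maximizer over \<open>x + h\<close> and \<open>y\<close> one over \<open>x\<close>, the left-hand side is \<open>g (x + h)\<close> and the
  gradient is that of \<open>g\<close> at \<open>x\<close>.
\<close>
lemma partial_increment:
  "F (x + h) y' \<le> F x y' + inner (Fx x y) h + L12 * dist y y' * norm h + L11 / 2 * (norm h)\<^sup>2"
proof -
  have "F (x + h) y' \<le> F x y' + inner (Fx x y') h + L11 / 2 * (norm h)\<^sup>2"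
    by (rule quadratic_upper_bound[OF der_x L11])
  moreover have "inner (Fx x y' - Fx x y) h \<le> norm (Fx x y' - Fx x y) * norm h"
    by (rule norm_cauchy_schwarz)
  moreover have "norm (Fx x y' - Fx x y) * norm h \<le> L12 * dist y y' * norm h"
    using lipschitz_onD[OF L12_x, of y' y x]
    by (intro mult_right_mono) (auto simp: dist_norm norm_minus_commute)
  ultimately show ?thesis by (simp add: inner_diff_left)
qed

text \<open>
  Here the maximizer over \<open>x + h\<close> is chosen near the given one over \<open>x\<close>, which makes the bound
  valid for every maximizer \<open>y\<close> over \<open>x\<close>, at the price of a constant too large for the step length
  of the outer method.  It serves only to compare gradients at different maximizers.
\<close>
lemma max_increment_crude:
  assumes "F x y = g x"
  shows "g (x + h) \<le> g x + inner (Fx x y) h + (L12\<^sup>2 / \<mu> + L11 / 2) * (norm h)\<^sup>2"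
proof -
  obtain p where p: "F (x + h) p = g (x + h)" "\<mu> * dist y p \<le> norm (Fy (x + h) y)"
    by (rule error_bound)
  have "norm (Fy (x + h) y) \<le> L12 * norm h"
    using lipschitz_onD[OF L12_y, of "x + h" x y] Fy_maximizer[OF assms] by (simp add: dist_norm)
  with p(2) have "dist y p \<le> L12 * norm h / \<mu>" using \<mu> by (simp add: field_simps)
  then have "L12 * dist y p * norm h \<le> L12 * (L12 * norm h / \<mu>) * norm h"
    using L12_nonneg by (intro mult_right_mono mult_left_mono) auto
  also have "\<dots> = L12\<^sup>2 / \<mu> * (norm h)\<^sup>2" by (simp add: power2_eq_square)
  finally show ?thesis
    using partial_increment[of x h p y] p(1) le_max[of x p] by (simp add: algebra_simps)
qed

text \<open>
  Each maximizer over \<open>x\<close> also gives a lower bound \<open>F (x + h) y' \<le> g (x + h)\<close>.  The linear parts of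
  the lower bound from \<open>y'\<close> and the upper bound from \<open>y\<close> must agree, since their difference is at most a
  multiple of \<open>(norm h)\<^sup>2\<close> in every direction.
\<close>
lemma Fx_maximizers_eq:
  assumes y: "F x y = g x" and y': "F x y' = g x"
  shows "Fx x y = Fx x y'"
proof (rule ccontr)
  define d where "d = Fx x y' - Fx x y"
  define C where "C = L12\<^sup>2 / \<mu> + L11"
  assume "Fx x y \<noteq> Fx x y'"
  then have d: "norm d > 0" by (simp add: d_def)
  have "C \<ge> 0" using \<mu> lipschitz_on_nonneg[OF L11] by (simp add: C_def)
  define t where "t = 1 / (C + 1)"
  have t: "t > 0" "t * C < 1" using \<open>C \<ge> 0\<close> by (auto simp: t_def)
  have "F x y' + inner (Fx x y') (t *\<^sub>R d) - L11 / 2 * (norm (t *\<^sub>R d))\<^sup>2 \<le> F (x + t *\<^sub>R d) y'"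
    by (rule quadratic_lower_bound[OF der_x L11])
  also have "\<dots> \<le> g (x + t *\<^sub>R d)" by (rule le_max)
  also have "\<dots> \<le> g x + inner (Fx x y) (t *\<^sub>R d) + (L12\<^sup>2 / \<mu> + L11 / 2) * (norm (t *\<^sub>R d))\<^sup>2"
    by (rule max_increment_crude[OF y])
  finally have "inner d (t *\<^sub>R d) \<le> C * (norm (t *\<^sub>R d))\<^sup>2"
    unfolding d_def inner_diff_left C_def using y' by (simp add: algebra_simps)
  then have "t * (norm d)\<^sup>2 \<le> t * (t * C * (norm d)\<^sup>2)"
    using t by (simp add: power2_norm_eq_inner[symmetric] power_mult_distrib)
      (simp add: power2_eq_square mult_ac)
  then have "(norm d)\<^sup>2 \<le> t * C * (norm d)\<^sup>2" using t by simp
  then show False using t d by simp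
qed

text \<open>
  In contrast to the crude bound, one starts from a maximizer \<open>y2\<close> over \<open>x + h\<close> and moves to a
  maximizer \<open>p\<close> over \<open>x\<close> at distance \<open>D\<close>.  Since \<open>y2\<close> is suboptimal over \<open>x\<close> by at least
  \<open>\<mu> / 2 * D\<^sup>2\<close>, this gain absorbs part of the error \<open>L12 * D * norm h\<close>, leaving half of
  \<open>L12\<^sup>2 / \<mu> * (norm h)\<^sup>2\<close>.  The point \<open>p\<close> depends on \<open>h\<close>; its \<open>x\<close>-gradient does not.
\<close>
lemma max_quadratic_upper_bound:
  assumes y: "F x y = g x"
  shows "g (x + h) \<le> g x + inner (Fx x y) h + (L11 + L12\<^sup>2 / \<mu>) / 2 * (norm h)\<^sup>2"
proof -
  obtain y2 where y2: "F (x + h) y2 = g (x + h)" using max_attained by blast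
  obtain p where p: "F x p = g x" "\<mu> / 2 * (dist y2 p)\<^sup>2 \<le> g x - F x y2"
    by (rule growth)
  define D where "D = dist y2 p"
  have "0 \<le> (\<mu> * D - L12 * norm h)\<^sup>2 / (2 * \<mu>)" using \<mu> by simp
  also have "\<dots> = \<mu> / 2 * D\<^sup>2 - L12 * D * norm h + L12\<^sup>2 / (2 * \<mu>) * (norm h)\<^sup>2"
    using \<mu> by (simp add: power2_eq_square field_simps)
  finally have "L12 * D * norm h \<le> \<mu> / 2 * D\<^sup>2 + L12\<^sup>2 / (2 * \<mu>) * (norm h)\<^sup>2" by simp
  moreover have "g (x + h) \<le> F x y2 + inner (Fx x p) h + L12 * D * norm h + L11 / 2 * (norm h)\<^sup>2"
    using partial_increment[of x h y2 p] y2 by (simp add: D_def dist_commute)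
  moreover have "Fx x p = Fx x y" by (rule Fx_maximizers_eq[OF p(1) y])
  ultimately show ?thesis using p(2) by (simp add: D_def algebra_simps add_divide_distrib)
qed

lemma inexact_step_decrease:
  assumes "L11 > 0" and inner_acc: "norm (Fy x y) \<le> \<mu> * \<gamma>"
    and large: "norm (Fx x y) > L12 * \<gamma> * sqrt 6" and "\<gamma> \<ge> 0"
  shows "g (x - (\<mu> / (L11 * \<mu> + L12\<^sup>2)) *\<^sub>R Fx x y)
    \<le> g x - (L12 * \<gamma>)\<^sup>2 / (2 * (L11 + L12\<^sup>2 / \<mu>))"
proof -
  define L where "L = L11 + L12\<^sup>2 / \<mu>"
  define v where "v = Fx x y"
  define \<Delta> where "\<Delta> = L12 * \<gamma>"
  have L: "L > 0" using \<mu> \<open>L11 > 0\<close> by (simp add: L_def add_pos_nonneg)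
  have \<Delta>: "\<Delta> \<ge> 0" using L12_nonneg \<open>\<gamma> \<ge> 0\<close> by (simp add: \<Delta>_def)
  have step: "\<mu> / (L11 * \<mu> + L12\<^sup>2) = 1 / L" using \<mu> by (simp add: L_def field_simps)
  obtain p where p: "F x p = g x" "\<mu> * dist y p \<le> norm (Fy x y)" by (rule error_bound)
  define w where "w = Fx x p"
  have "dist y p \<le> \<gamma>" using p(2) inner_acc \<mu> by (meson mult_le_cancel_left_pos order_trans)
  then have "L12 * dist y p \<le> \<Delta>" using L12_nonneg by (simp add: \<Delta>_def mult_left_mono)
  then have close: "norm (v - w) \<le> \<Delta>"
    using lipschitz_onD[OF L12_x, of y p x] by (simp add: v_def w_def dist_norm)
  have "g (x + (- (1 / L)) *\<^sub>R v) \<le> g x + inner w ((- (1 / L)) *\<^sub>R v)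
      + L / 2 * (norm ((- (1 / L)) *\<^sub>R v))\<^sup>2"
    using max_quadratic_upper_bound[OF p(1)] by (simp only: L_def w_def)
  also have "\<dots> = g x + ((norm (v - w))\<^sup>2 - (norm w)\<^sup>2) / (2 * L)"
    using L unfolding power2_norm_eq_inner
    by (simp add: inner_diff inner_commute field_simps power2_eq_square)
  also have "\<dots> \<le> g x - \<Delta>\<^sup>2 / (2 * L)"
  proof -
    have "sqrt (6::real) \<le> 5 / 2"
      by (rule real_le_lsqrt) (simp_all add: power2_eq_square)
    then have sqrt6: "1 \<le> sqrt (6::real)" "sqrt (6::real) \<le> 5 / 2" by simp_all
    have "2 * \<Delta>\<^sup>2 \<le> (7 - 2 * sqrt 6) * \<Delta>\<^sup>2"
      using sqrt6 by (intro mult_right_mono) auto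
    also have "\<dots> = ((sqrt 6 - 1) * \<Delta>)\<^sup>2"
      by (simp add: power_mult_distrib power2_diff)
    also have "(sqrt 6 - 1) * \<Delta> \<le> norm w"
      using large close norm_triangle_ineq2[of v w] by (simp add: v_def \<Delta>_def algebra_simps)
    then have "((sqrt 6 - 1) * \<Delta>)\<^sup>2 \<le> (norm w)\<^sup>2"
      using \<Delta> sqrt6 by (intro power_mono) auto
    finally have "2 * \<Delta>\<^sup>2 \<le> (norm w)\<^sup>2" .
    moreover have "(norm (v - w))\<^sup>2 \<le> \<Delta>\<^sup>2" using close by (intro power_mono) auto
    ultimately have "((norm (v - w))\<^sup>2 - (norm w)\<^sup>2) / (2 * L) \<le> (- \<Delta>\<^sup>2) / (2 * L)"
      using L by (intro divide_right_mono) auto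
    then show ?thesis by simp
  qed
  finally show ?thesis by (simp add: step v_def L_def \<Delta>_def)
qed

end

section \<open>Counting the outer iterations\<close>

theorem mainTheorem2:
  fixes f :: "(real ^ 'n) \<times> (real ^ 'm) \<Rightarrow> real"
    and \<mu>1 \<mu>2 L11 L12 L22 \<gamma> C1 :: real
    and xs :: "real ^ 'n" and ys :: "real ^ 'm"
    and x :: "nat \<Rightarrow> real ^ 'n"
    and y0 yhat :: "nat \<Rightarrow> real ^ 'm"
  assumes "f differentiable_on UNIV"
    and "\<mu>1 > 0" and "\<mu>2 > 0" and "two_sided_PL f \<mu>1 \<mu>2"
    and "L11 > 0" and "L12 > 0" and "L22 > 0" and "lipschitz_gradients f L11 L12 L22"
    and "\<forall>x. max_y f xs \<le> max_y f x" and "f (xs, ys) = (INF x. max_y f x)"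
    and "\<gamma> > 0"
    and "\<forall>k. yhat k = inner_output f L22 (\<mu>2 * \<gamma>) (x k) (y0 k)"
    and "\<forall>k. x (Suc k) = x k - (\<mu>2 / (L11 * \<mu>2 + L12\<^sup>2)) *\<^sub>R grad_x f (x k) (yhat k)"
    and "C1 \<ge> 0" and "max_y f (x 0) - max_y f xs \<le> C1"
  shows "\<exists>N. int N \<le> \<lceil>2 * C1 * ((L11 + L12\<^sup>2 / \<mu>2) / (L12\<^sup>2 * \<gamma>\<^sup>2))\<rceil> \<and>
             norm (grad_x f (x N) (yhat N)) \<le> L12 * \<gamma> * sqrt 6"
proof (rule ccontr)
  assume no_stop: "\<not> ?thesis"
  have f_diff: "f differentiable (at z)" for z
    using assms(1) unfolding differentiable_on_def by blast
  have der_x: "GDERIV (\<lambda>x. f (x, y)) x :> grad_x f x y" for x y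
  proof -
    have "(\<lambda>x. (x, y)) differentiable (at x)"
      unfolding differentiable_def by (rule exI) (rule derivative_intros)+
    then have "(f \<circ> (\<lambda>x. (x, y))) differentiable (at x)"
      by (intro differentiable_chain_at f_diff)
    then show ?thesis
      unfolding grad_x_def by (intro GDERIV_grad) (simp add: o_def)
  qed
  have der_y: "GDERIV (\<lambda>y. f (x, y)) y :> grad_y f x y" for x y
  proof -
    have "(\<lambda>y. (x, y)) differentiable (at y)"
      unfolding differentiable_def by (rule exI) (rule derivative_intros)+
    then have "(f \<circ> (\<lambda>y. (x, y))) differentiable (at y)"
      by (intro differentiable_chain_at f_diff)
    then show ?thesis
      unfolding grad_y_def by (intro GDERIV_grad) (simp add: o_def)
  qed
  have max_ex: "\<exists>y. \<forall>y'. f (x, y') \<le> f (x, y)" for x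
    using assms(4) by (simp add: two_sided_PL_def)
  then have bdd: "bdd_above (range (\<lambda>y. f (x, y)))" for x
    by (metis bdd_above.I2)
  have le_max: "f (x, y) \<le> max_y f x" for x y
    unfolding max_y_def by (rule cSUP_upper[OF UNIV_I bdd])
  have attained: "\<exists>y. f (x, y) = max_y f x" for x
  proof -
    obtain y where "\<forall>y'. f (x, y') \<le> f (x, y)" using max_ex by blast
    then have "max_y f x \<le> f (x, y)" unfolding max_y_def by (intro cSUP_least) auto
    then show ?thesis using le_max by (metis antisym)
  qed
  interpret PL_max "\<lambda>x y. f (x, y)" "grad_x f" "grad_y f" "max_y f" \<mu>2 L11 L12
    using assms(3,4,8) der_x der_y le_max attained
    by unfold_locales (auto simp: two_sided_PL_def lipschitz_gradients_def)
  have accurate: "norm (grad_y f (x k) (yhat k)) \<le> \<mu>2 * \<gamma>" for k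
  proof -
    have "L22-lipschitz_on UNIV (grad_y f (x k))"
      using assms(8) by (simp add: lipschitz_gradients_def)
    then have "\<exists>m. norm (grad_y f (x k) (inner_iterate f L22 (x k) (y0 k) m)) \<le> \<mu>2 * \<gamma>"
      using assms(1,3,7,11) bdd by (intro inner_method_stops) auto
    from LeastI_ex[OF this] show ?thesis
      using assms(12) by (simp add: inner_output_def)
  qed
  define K where "K = 2 * C1 * ((L11 + L12\<^sup>2 / \<mu>2) / (L12\<^sup>2 * \<gamma>\<^sup>2))"
  define \<eta> where "\<eta> = (L12 * \<gamma>)\<^sup>2 / (2 * (L11 + L12\<^sup>2 / \<mu>2))"
  have pos: "L11 + L12\<^sup>2 / \<mu>2 > 0" using assms(3,5) by (simp add: add_pos_nonneg)
  then have \<eta>: "\<eta> > 0" using assms(6,11) by (simp add: \<eta>_def)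
  have "2 * C1 * (s / d) * (d / (2 * s)) = C1" if "s > 0" "d > 0" for s d :: real
    using that by simp
  from this[OF pos, of "(L12 * \<gamma>)\<^sup>2"] have K\<eta>: "K * \<eta> = C1"
    using assms(6,11) by (simp only: K_def \<eta>_def power_mult_distrib) simp
  have "K \<ge> 0" using pos assms(14) by (simp add: K_def)
  have decrease: "max_y f (x (Suc k)) \<le> max_y f (x k) - \<eta>" if "int k \<le> \<lceil>K\<rceil>" for k
  proof -
    have "norm (grad_x f (x k) (yhat k)) > L12 * \<gamma> * sqrt 6"
      using no_stop that unfolding K_def by (meson not_le)
    with accurate[of k] show ?thesis
      using inexact_step_decrease[of "x k" "yhat k" \<gamma>] assms(5,11,13) by (simp add: \<eta>_def)
  qed
  have total: "max_y f (x k) \<le> max_y f (x 0) - real k * \<eta>" if "int k \<le> \<lceil>K\<rceil> + 1" for k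
    using that
  proof (induction k)
    case (Suc k)
    then show ?case using decrease[of k] by (simp add: algebra_simps)
  qed simp
  \<comment> \<open>The iterations \<open>0, \<dots>, \<lceil>K\<rceil>\<close> all fail to stop, which makes \<open>\<lceil>K\<rceil> + 1\<close> decreasing steps.\<close>
  define n where "n = Suc (nat \<lceil>K\<rceil>)"
  have "int n = \<lceil>K\<rceil> + 1" using \<open>K \<ge> 0\<close> by (simp add: n_def)
  then have "max_y f (x n) \<le> max_y f (x 0) - real n * \<eta>" by (intro total) simp
  moreover have "K < real n" unfolding n_def using real_nat_ceiling_ge[of K] by simp
  then have "C1 < real n * \<eta>" using \<eta> K\<eta> by (metis mult_less_cancel_right_pos)
  moreover have "max_y f xs \<le> max_y f (x n)" using assms(9) by blast
  ultimately show False using assms(15) by linarith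
qed

end
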